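(* For every integer $n\ge2$, the oriented skew $(\mathbb{Z}/n\mathbb{Z})$-circulant corresponding to the transitive tournament on $n$ vertices, i.e. the oriented graph with $n\times n$ Hermitian adjacency matrix $B$ given by $B_{j,k}=-i$ for $j<k$, $B_{j,k}=i$ for $j>k$ and $B_{j,j}=0$, has average uniform mixing: its average mixing matrix equals $\frac1nJ_n$.
   Context: A skew-circulant matrix with first row $(a_0,\dots,a_{n-1})$ is $\sum_{j=0}^{n-1}a_jP^j$, where $P$ maps $e_j$ to $e_{j-1}$ for $1\le j\le n-1$ and $e_0$ to $-e_{n-1}$. The matrix $B$ is $-i$ times the skew-circulant matrix with first row $(0,1,1,\dots,1)$. For a graph $X$ of order $n$ with Hermitian adjacency matrix $B$, let $U_X(t)=e^{-itB}$ and $M_X(t)=U_X(t)\circ\overline{U_X(t)}$ (entrywise product). The average mixing matrix is $\widehat{M}_X=\lim_{T\to\infty}\frac1T\int_0^TM_X(t)\,dt$. $X$ has average uniform mixing if $\widehat{M}_X=\frac1nJ_n$, where $J_n$ is the all-one matrix. *)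

theory Defs
  imports
    "HOL-Analysis.Analysis"
    "Jordan_Normal_Form.Matrix"
begin

(* Columns are images of basis vectors: e_c is sent to e_(c-1) for c >= 1, and e_0 to -e_(n-1). *)
definition skew_shift :: "nat \<Rightarrow> complex mat" where
  "skew_shift n = mat n n (\<lambda>(r, c).
     if Suc r = c then 1 else if c = 0 \<and> Suc r = n then -1 else 0)"

(* The matrix sum is written entrywise because the type of matrices, covering all dimensions
   at once, has no zero element and hence no sum operator. *)
definition skew_circulant :: "nat \<Rightarrow> (nat \<Rightarrow> complex) \<Rightarrow> complex mat" where
  "skew_circulant n a = mat n n (\<lambda>(r, c). \<Sum>j<n. a j * (skew_shift n ^\<^sub>m j) $$ (r, c))"

definition mat_exp :: "complex mat \<Rightarrow> complex mat" where
  "mat_exp A = mat (dim_row A) (dim_row A) (\<lambda>(r, c). \<Sum>m. (A ^\<^sub>m m) $$ (r, c) / fact m)"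

definition transition_matrix :: "complex mat \<Rightarrow> real \<Rightarrow> complex mat" where
  "transition_matrix B t = mat_exp ((- \<i> * complex_of_real t) \<cdot>\<^sub>m B)"

definition mixing_matrix :: "complex mat \<Rightarrow> real \<Rightarrow> complex mat" where
  "mixing_matrix B t = mat (dim_row B) (dim_row B) (\<lambda>(j, k).
     transition_matrix B t $$ (j, k) * cnj (transition_matrix B t $$ (j, k)))"

(* A relation rather than a function, so that asserting it includes existence of the limit. *)
definition has_average_mixing_matrix :: "complex mat \<Rightarrow> complex mat \<Rightarrow> bool" where
  "has_average_mixing_matrix B M \<longleftrightarrow>
     M \<in> carrier_mat (dim_row B) (dim_row B) \<and>
     (\<forall>j < dim_row B. \<forall>k < dim_row B.
        ((\<lambda>T. (1 / T) *\<^sub>R integral {0..T} (\<lambda>t. mixing_matrix B t $$ (j, k)))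
           \<longlongrightarrow> M $$ (j, k)) at_top)"

definition all_ones_mat :: "nat \<Rightarrow> complex mat" where
  "all_ones_mat n = mat n n (\<lambda>_. 1)"

definition average_uniform_mixing :: "complex mat \<Rightarrow> bool" where
  "average_uniform_mixing B \<longleftrightarrow>
     has_average_mixing_matrix B ((1 / of_nat (dim_row B)) \<cdot>\<^sub>m all_ones_mat (dim_row B))"

end

theory Submission
  imports Defs
begin

text \<open>
  The vectors \<open>(1, z, \<dots>, z^(n-1))\<close> with \<open>z^n = -1\<close> diagonalise every skew-circulant matrix, and for
  the transitive tournament the eigenvalue attached to \<open>z\<close> is \<open>\<i> * (1 + z) / (1 - z)\<close>. These values
  are real, and distinct because a Moebius map is injective. With simple spectrum, averaging over
  time kills all cross terms, so entry \<open>(j, k)\<close> of the average mixing matrix is the sum over the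
  \<open>n\<close> eigenprojections of the squared modulus of their \<open>(j, k)\<close> entry, which is \<open>1 / n\<^sup>2\<close> each time.
\<close>

section \<open>Powers of the skew shift\<close>

lemma skew_shift_carrier [simp]: "skew_shift n \<in> carrier_mat n n"
  by (simp add: skew_shift_def)

text \<open>Each factor moves the index by one and contributes a sign only when it wraps around. As
  \<open>r < n\<close> and \<open>j < n\<close>, at most one wrap occurs, so a single case with
  \<open>-1\<close> suffices.\<close>

lemma skew_shift_power:
  assumes "j < n" "r < n" "c < n"
  shows "(skew_shift n ^\<^sub>m j) $$ (r, c) = (if c = r + j then 1 else if c + n = r + j then -1 else 0)"
  using assms
proof (induction j arbitrary: c)
  case 0
  then show ?case by (auto simp: skew_shift_def)
next
  case (Suc j)
  have "(skew_shift n ^\<^sub>m Suc j) $$ (r, c)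
      = (\<Sum>k<n. (skew_shift n ^\<^sub>m j) $$ (r, k) * skew_shift n $$ (k, c))"
    using Suc.prems carrier_matD[OF pow_carrier_mat[OF skew_shift_carrier[of n], of j]]
      carrier_matD[OF skew_shift_carrier[of n]]
    by (simp add: scalar_prod_def lessThan_atLeast0)
  \<comment> \<open>Column \<open>c\<close> of the shift has one nonzero entry: \<open>1\<close> in
    row \<open>c - 1\<close>, or \<open>-1\<close> in row \<open>n - 1\<close> when
    \<open>c = 0\<close>.\<close>
  also have "\<dots> = (\<Sum>k<n. if k = (if c = 0 then n - 1 else c - 1)
      then (skew_shift n ^\<^sub>m j) $$ (r, k) * (if c = 0 then -1 else 1) else 0)"
    using Suc.prems by (intro sum.cong) (auto simp: skew_shift_def)
  also have "\<dots> = (skew_shift n ^\<^sub>m j) $$ (r, if c = 0 then n - 1 else c - 1) * (if c = 0 then -1 else 1)"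
    using Suc.prems by (subst sum.delta) auto
  also have "\<dots> = (if c = r + Suc j then 1 else if c + n = r + Suc j then -1 else 0)"
    using Suc.prems Suc.IH[of "if c = 0 then n - 1 else c - 1"] by (auto split: if_splits)
  finally show ?case .
qed

lemma skew_circulant_index:
  assumes "r < n" "c < n"
  shows "skew_circulant n a $$ (r, c) = (if r \<le> c then a (c - r) else - a (n + c - r))"
proof -
  have "skew_circulant n a $$ (r, c) = (\<Sum>j<n. a j * (skew_shift n ^\<^sub>m j) $$ (r, c))"
    using assms by (simp add: skew_circulant_def)
  \<comment> \<open>For fixed \<open>r\<close> and \<open>c\<close> exactly one power below
    \<open>n\<close> reaches column \<open>c\<close> from row \<open>r\<close>: the
    \<open>(c - r)\<close>-th without a wrap, or the \<open>(n + c - r)\<close>-th with one.\<close>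
  also have "\<dots> = (\<Sum>j<n. if j = (if r \<le> c then c - r else n + c - r)
      then (if r \<le> c then a j else - a j) else 0)"
    using assms by (intro sum.cong) (auto simp: skew_shift_power)
  also have "\<dots> = (if r \<le> c then a (c - r) else - a (n + c - r))"
    using assms by (subst sum.delta) auto
  finally show ?thesis .
qed

section \<open>The exponential of a diagonalised matrix\<close>

text \<open>A spectral decomposition in rank-one form: \<open>complete\<close> resolves the identity
  into the products of the columns \<open>x s\<close> with the rows \<open>y s\<close>, and
  \<open>eigen\<close> makes each \<open>y s\<close> a left eigenvector, so every multiplication by
  \<open>A\<close> on the right yields one more factor \<open>\<mu> s\<close>.\<close>

lemma pow_mat_index_spectral:
  fixes x y :: "'s \<Rightarrow> nat \<Rightarrow> complex"
  assumes A: "A \<in> carrier_mat n n"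
    and complete: "\<And>r c. r < n \<Longrightarrow> c < n \<Longrightarrow> (\<Sum>s\<in>S. x s r * y s c) = (if r = c then 1 else 0)"
    and eigen: "\<And>s c. s \<in> S \<Longrightarrow> c < n \<Longrightarrow> (\<Sum>k<n. y s k * A $$ (k, c)) = \<mu> s * y s c"
    and "r < n" "c < n"
  shows "(A ^\<^sub>m m) $$ (r, c) = (\<Sum>s\<in>S. \<mu> s ^ m * (x s r * y s c))"
  using \<open>c < n\<close>
proof (induction m arbitrary: c)
  case 0
  then show ?case using A \<open>r < n\<close> by (simp add: complete)
next
  case (Suc m)
  have "(A ^\<^sub>m Suc m) $$ (r, c) = (\<Sum>k<n. (A ^\<^sub>m m) $$ (r, k) * A $$ (k, c))"
    using Suc.prems \<open>r < n\<close> carrier_matD[OF A] carrier_matD[OF pow_carrier_mat[OF A, of m]]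
    by (simp add: scalar_prod_def lessThan_atLeast0)
  also have "\<dots> = (\<Sum>k<n. \<Sum>s\<in>S. \<mu> s ^ m * x s r * (y s k * A $$ (k, c)))"
    by (intro sum.cong refl) (simp add: Suc.IH sum_distrib_right mult.assoc)
  also have "\<dots> = (\<Sum>s\<in>S. \<mu> s ^ m * x s r * (\<Sum>k<n. y s k * A $$ (k, c)))"
    by (subst sum.swap) (simp add: sum_distrib_left)
  also have "\<dots> = (\<Sum>s\<in>S. \<mu> s ^ Suc m * (x s r * y s c))"
    using Suc.prems by (intro sum.cong refl) (simp add: eigen mult_ac)
  finally show ?case .
qed

lemma mat_exp_index_spectral:
  fixes x y :: "'s \<Rightarrow> nat \<Rightarrow> complex"
  assumes A: "A \<in> carrier_mat n n"
    and complete: "\<And>r c. r < n \<Longrightarrow> c < n \<Longrightarrow> (\<Sum>s\<in>S. x s r * y s c) = (if r = c then 1 else 0)"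
    and eigen: "\<And>s c. s \<in> S \<Longrightarrow> c < n \<Longrightarrow> (\<Sum>k<n. y s k * A $$ (k, c)) = \<mu> s * y s c"
    and rc: "r < n" "c < n"
  shows "mat_exp A $$ (r, c) = (\<Sum>s\<in>S. exp (\<mu> s) * (x s r * y s c))"
proof -
  have "(\<lambda>m. \<Sum>s\<in>S. \<mu> s ^ m /\<^sub>R fact m * (x s r * y s c)) sums (\<Sum>s\<in>S. exp (\<mu> s) * (x s r * y s c))"
    by (intro sums_sum sums_mult2 exp_converges)
  also have "(\<lambda>m. \<Sum>s\<in>S. \<mu> s ^ m /\<^sub>R fact m * (x s r * y s c)) = (\<lambda>m. (A ^\<^sub>m m) $$ (r, c) / fact m)"
    by (simp add: pow_mat_index_spectral[OF A complete eigen rc] sum_divide_distrib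
        scaleR_conv_of_real field_simps)
  finally show ?thesis
    using A rc by (simp add: mat_exp_def sums_iff)
qed

section \<open>Time averages of trigonometric polynomials\<close>

lemma integral_exp_imaginary:
  assumes "a \<noteq> 0" "0 \<le> T"
  shows "((\<lambda>t. exp (\<i> * of_real (a * t))) has_integral
      (exp (\<i> * of_real (a * T)) - 1) / (\<i> * of_real a)) {0..T}"
proof -
  have "((\<lambda>t. exp (\<i> * of_real (a * t))) has_integral
      exp (\<i> * of_real (a * T)) / (\<i> * of_real a) - exp (\<i> * of_real (a * 0)) / (\<i> * of_real a)) {0..T}"
  proof (rule fundamental_theorem_of_calculus[OF \<open>0 \<le> T\<close>])
    fix t
    have "((\<lambda>z. exp (\<i> * (of_real a * z)) / (\<i> * of_real a)) has_field_derivative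
        exp (\<i> * (of_real a * of_real t))) (at (of_real t))"
      using \<open>a \<noteq> 0\<close> by (auto intro!: derivative_eq_intros simp: field_simps)
    then show "((\<lambda>t. exp (\<i> * of_real (a * t)) / (\<i> * of_real a)) has_vector_derivative
        exp (\<i> * of_real (a * t))) (at t within {0..T})"
      using has_vector_derivative_real_field by force
  qed
  then show ?thesis by (simp add: diff_divide_distrib)
qed

text \<open>For \<open>a \<noteq> 0\<close> the integral is a bounded oscillation, of norm at most
  \<open>2 / \<bar>a\<bar>\<close> for every \<open>T\<close>, so division by \<open>T\<close> sends
  it to 0. For \<open>a = 0\<close> the integrand is constantly 1.\<close>

lemma mean_exp_imaginary:
  "((\<lambda>T. (1 / T) *\<^sub>R integral {0..T} (\<lambda>t. exp (\<i> * of_real (a * t)))) \<longlongrightarrow> (if a = 0 then 1 else 0)) at_top"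
proof (cases "a = 0")
  case True
  have "eventually (\<lambda>T. (1 / T) *\<^sub>R integral {0..T} (\<lambda>t. exp (\<i> * of_real (a * t))) = 1) at_top"
    using eventually_gt_at_top[of 0]
    by eventually_elim (simp add: True scaleR_conv_of_real)
  then show ?thesis using True by (simp add: tendsto_eventually)
next
  case False
  have "((\<lambda>T. (1 / T) *\<^sub>R integral {0..T} (\<lambda>t. exp (\<i> * of_real (a * t)))) \<longlongrightarrow> 0) at_top"
  proof (rule Lim_null_comparison)
    show "((\<lambda>T. (2 / \<bar>a\<bar>) * inverse T) \<longlongrightarrow> 0) at_top"
      by (intro tendsto_mult_right_zero tendsto_inverse_0_at_top filterlim_ident)
    show "eventually (\<lambda>T. norm ((1 / T) *\<^sub>R integral {0..T} (\<lambda>t. exp (\<i> * of_real (a * t))))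
        \<le> (2 / \<bar>a\<bar>) * inverse T) at_top"
      using eventually_gt_at_top[of 0]
    proof eventually_elim
      case (elim T)
      have "norm (exp (\<i> * of_real (a * T)) - 1) \<le> 2"
        using norm_triangle_ineq4[of "exp (\<i> * of_real (a * T))" 1] by (simp only: norm_exp_i_times) simp
      then have "norm (integral {0..T} (\<lambda>t. exp (\<i> * of_real (a * t)))) \<le> 2 / \<bar>a\<bar>"
        using integral_unique[OF integral_exp_imaginary[OF False]] elim
        by (simp add: norm_divide norm_mult divide_right_mono del: of_real_mult)
      then show ?case
        using elim by (simp add: field_simps)
    qed
  qed
  then show ?thesis using False by simp
qed

text \<open>Expanding the product gives terms of frequency \<open>l s' - l s\<close>. By injectivity
  of \<open>l\<close> this vanishes only for \<open>s = s'\<close>, so only the diagonal terms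
  survive averaging.\<close>

lemma mean_norm_square_exp_sum:
  fixes l :: "'s \<Rightarrow> real" and a :: "'s \<Rightarrow> complex"
  assumes "finite S" "inj_on l S"
  defines "f \<equiv> \<lambda>t. \<Sum>s\<in>S. exp (- \<i> * of_real (l s * t)) * a s"
  shows "((\<lambda>T. (1 / T) *\<^sub>R integral {0..T} (\<lambda>t. f t * cnj (f t)))
      \<longlongrightarrow> (\<Sum>s\<in>S. of_real ((norm (a s))\<^sup>2))) at_top"
proof -
  let ?e = "\<lambda>s s' t. exp (\<i> * of_real ((l s' - l s) * t))"
  have f: "f t * cnj (f t) = (\<Sum>s\<in>S. \<Sum>s'\<in>S. a s * cnj (a s') * ?e s s' t)" for t
    by (simp add: f_def sum_product exp_cnj algebra_simps flip: exp_add)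
  have "?e s s' integrable_on {0..T}" for s s' T
    by (intro integrable_continuous_interval continuous_intros)
  then have int: "integral {0..T} (\<lambda>t. f t * cnj (f t))
      = (\<Sum>s\<in>S. \<Sum>s'\<in>S. a s * cnj (a s') * integral {0..T} (?e s s'))" for T
    using \<open>finite S\<close> unfolding f
    by (simp add: integral_sum integrable_sum integrable_on_mult_right del: of_real_mult of_real_diff)
  have "((\<lambda>T. \<Sum>s\<in>S. \<Sum>s'\<in>S. a s * cnj (a s') * ((1 / T) *\<^sub>R integral {0..T} (?e s s')))
      \<longlongrightarrow> (\<Sum>s\<in>S. \<Sum>s'\<in>S. a s * cnj (a s') * (if l s' - l s = 0 then 1 else 0))) at_top"
    by (intro tendsto_sum tendsto_mult tendsto_const mean_exp_imaginary)
  also have "(\<lambda>T. \<Sum>s\<in>S. \<Sum>s'\<in>S. a s * cnj (a s') * ((1 / T) *\<^sub>R integral {0..T} (?e s s')))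
      = (\<lambda>T. (1 / T) *\<^sub>R integral {0..T} (\<lambda>t. f t * cnj (f t)))"
    unfolding int by (simp add: scaleR_sum_right)
  also have "(\<Sum>s\<in>S. \<Sum>s'\<in>S. a s * cnj (a s') * (if l s' - l s = 0 then 1 else 0))
      = (\<Sum>s\<in>S. \<Sum>s'\<in>S. if s' = s then a s * cnj (a s') else 0)"
    using \<open>inj_on l S\<close> by (intro sum.cong refl) (auto dest: inj_onD)
  also have "\<dots> = (\<Sum>s\<in>S. of_real ((norm (a s))\<^sup>2))"
    using \<open>finite S\<close> by (simp only: sum.delta) (simp add: complex_norm_square del: of_real_power)
  finally show ?thesis .
qed

section \<open>The roots of \<open>z^n = -1\<close>\<close>

lemma card_roots_minus_one:
  assumes "n > 0"
  shows "card {z::complex. z ^ n = -1} = n"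
  using card_nth_roots[of "-1" n] assms by simp

lemma finite_roots_minus_one:
  assumes "n > 0"
  shows "finite {z::complex. z ^ n = -1}"
  using card_roots_minus_one[OF assms] assms card_ge_0_finite by force

lemma norm_root_minus_one:
  assumes "n > 0" "z ^ n = (-1::complex)"
  shows "norm z = 1"
  using assms by (metis norm_minus_cancel norm_one norm_power norm_ge_zero power_eq_1_iff
      less_numeral_extra(3) power_eq_imp_eq_base power_one)

text \<open>Multiplication by a primitive \<open>n\<close>-th root of unity \<open>\<eta>\<close>
  permutes the roots of \<open>z ^ n = -1\<close>. The power sum therefore equals
  \<open>\<eta> ^ d\<close> times itself, and \<open>\<eta> ^ d \<noteq> 1\<close>.\<close>

lemma sum_power_roots_minus_one:
  assumes "0 < d" "d < n"
  shows "(\<Sum>z\<in>{z::complex. z ^ n = -1}. z ^ d) = 0"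
proof -
  let ?Z = "{z::complex. z ^ n = -1}"
  define \<eta> where "\<eta> = exp (2 * of_real pi * \<i> * of_nat 1 / of_nat n)"
  have \<eta>: "\<eta> ^ n = 1" "\<eta> \<noteq> 0"
    using assms complex_root_unity[of n 1] by (auto simp: \<eta>_def)
  have "\<eta> ^ d = exp (2 * of_real pi * \<i> * of_nat d / of_nat n)"
    by (simp add: \<eta>_def mult_ac flip: exp_of_nat_mult)
  moreover have "\<not> n dvd d"
    using assms by (simp add: nat_dvd_not_less)
  ultimately have \<eta>d: "\<eta> ^ d \<noteq> 1"
    using assms complex_root_unity_eq_1[of n d] by auto
  have "bij_betw (\<lambda>z. \<eta> * z) ?Z ?Z"
    by (rule bij_betw_byWitness[where f' = "\<lambda>z. z / \<eta>"])
       (use \<eta> in \<open>auto simp: power_mult_distrib power_divide\<close>)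
  then have "(\<Sum>z\<in>?Z. (\<eta> * z) ^ d) = (\<Sum>z\<in>?Z. z ^ d)"
    by (rule sum.reindex_bij_betw)
  then have "(\<eta> ^ d - 1) * (\<Sum>z\<in>?Z. z ^ d) = 0"
    by (simp add: power_mult_distrib left_diff_distrib flip: sum_distrib_left)
  then show ?thesis using \<eta>d by simp
qed

text \<open>After division by \<open>n\<close> this is the resolution of the identity for the
  eigenvectors. On the unit circle the summand is \<open>z ^ (c - r)\<close> if
  \<open>r \<le> c\<close>; conjugating the sum exchanges \<open>r\<close> and
  \<open>c\<close>.\<close>

lemma sum_cnj_power_mult_power_roots_minus_one:
  assumes "r < n" "c < n"
  shows "(\<Sum>z\<in>{z::complex. z ^ n = -1}. cnj z ^ r * z ^ c) = (if r = c then of_nat n else 0)"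
proof -
  let ?Z = "{z::complex. z ^ n = -1}"
  have unit: "cnj z * z = 1" if "z \<in> ?Z" for z
    using norm_root_minus_one[of n z] that assms complex_norm_square[of z] by (simp add: mult.commute)
  have le: "(\<Sum>z\<in>?Z. cnj z ^ r * z ^ c) = (if r = c then of_nat n else 0)"
    if "r \<le> c" "c < n" for r c
  proof -
    have "cnj z ^ r * z ^ c = z ^ (c - r)" if "z \<in> ?Z" for z
    proof -
      have "cnj z ^ r * z ^ c = (cnj z * z) ^ r * z ^ (c - r)"
        using \<open>r \<le> c\<close> by (simp add: power_mult_distrib mult.assoc flip: power_add)
      then show ?thesis using unit[OF that] by simp
    qed
    then have "(\<Sum>z\<in>?Z. cnj z ^ r * z ^ c) = (\<Sum>z\<in>?Z. z ^ (c - r))"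
      by (intro sum.cong) auto
    then show ?thesis
      using that sum_power_roots_minus_one[of "c - r" n] card_roots_minus_one[of n] by auto
  qed
  show ?thesis
  proof (cases "r \<le> c")
    case False
    have "(\<Sum>z\<in>?Z. cnj z ^ r * z ^ c) = cnj (\<Sum>z\<in>?Z. cnj z ^ c * z ^ r)"
      by (simp add: mult.commute)
    then show ?thesis using le[of c r] False assms by simp
  qed (use le assms in auto)
qed

section \<open>The transitive tournament\<close>

lemma tournament_eigenvalue:
  fixes z :: complex
  assumes "z ^ n = -1" "c < n"
  shows "(\<Sum>k<n. z ^ k * (if k < c then - \<i> else if k > c then \<i> else 0))
    = \<i> * (1 + z) / (1 - z) * z ^ c"
proof -
  have z: "z \<noteq> 1" using assms by auto
  \<comment> \<open>The terms with \<open>k > c\<close> are all terms minus those with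
    \<open>k < Suc c\<close>, which leaves only initial segments of the geometric series.\<close>
  have "(\<Sum>k<n. z ^ k * (if k < c then - \<i> else if k > c then \<i> else 0))
      = (\<Sum>k<n. \<i> * (z ^ k - (if k < Suc c then z ^ k else 0) - (if k < c then z ^ k else 0)))"
    by (intro sum.cong) auto
  also have "\<dots> = \<i> * ((\<Sum>k<n. z ^ k) - (\<Sum>k<Suc c. z ^ k) - (\<Sum>k<c. z ^ k))"
  proof -
    have "(\<Sum>k<n. if k < m then z ^ k else 0) = (\<Sum>k<m. z ^ k)" if "m \<le> n" for m
      using that by (intro sum.mono_neutral_cong_right) auto
    then show ?thesis
      using assms by (simp add: sum_subtractf flip: sum_distrib_left del: sum.lessThan_Suc)
  qed
  also have "\<dots> = \<i> * ((z ^ n - 1) / (z - 1) - (z ^ Suc c - 1) / (z - 1) - (z ^ c - 1) / (z - 1))"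
    by (simp only: geometric_sum[OF z])
  \<comment> \<open>As \<open>z ^ n = -1\<close>, the constants in the three numerators cancel and
    \<open>- (1 + z) * z ^ c\<close> remains.\<close>
  also have "\<dots> = \<i> * (1 + z) / (1 - z) * z ^ c"
    using z assms by (simp add: divide_simps) (simp add: algebra_simps)
  finally show ?thesis .
qed

text \<open>On the unit circle conjugation is inversion, which negates
  \<open>(1 + z) / (1 - z)\<close>; conjugation also negates \<open>\<i>\<close>, and the two signs
  cancel. At \<open>z = 1\<close> division by zero gives the value 0.\<close>

lemma tournament_eigenvalue_real:
  assumes "norm z = 1"
  shows "\<i> * (1 + z) / (1 - z) \<in> \<real>"
proof -
  have "cnj z * z = 1"
    using assms complex_norm_square[of z] by (simp add: mult.commute)
  moreover from this have "z \<noteq> 0" by auto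
  ultimately have "cnj z = 1 / z" "z \<noteq> 0"
    by (simp_all add: nonzero_eq_divide_eq)
  then have "cnj (\<i> * (1 + z) / (1 - z)) = \<i> * (1 + z) / (1 - z)"
    by (simp add: divide_simps) (simp add: algebra_simps)
  then show ?thesis by (simp add: Reals_cnj_iff)
qed

text \<open>This yields the simple spectrum. The pole 1 is excluded because the quotient defaults to
  0 there, which is also its value at \<open>-1\<close>.\<close>

lemma tournament_eigenvalue_inj: "inj_on (\<lambda>z::complex. \<i> * (1 + z) / (1 - z)) (- {1})"
proof (rule inj_onI)
  fix z w :: complex
  assume "z \<in> - {1}" "w \<in> - {1}" "\<i> * (1 + z) / (1 - z) = \<i> * (1 + w) / (1 - w)"
  then have "(1 + z) * (1 - w) = (1 + w) * (1 - z)"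
    by (simp add: frac_eq_eq)
  then have "2 * z = 2 * w" by (simp add: algebra_simps)
  then show "z = w" by simp
qed

lemma tournament_average_uniform_mixing:
  assumes "n > 0"
  shows "average_uniform_mixing (mat n n (\<lambda>(j, k). if j < k then - \<i> else if j > k then \<i> else 0))"
    (is "average_uniform_mixing ?B")
proof -
  let ?Z = "{z::complex. z ^ n = -1}"
  define l where "l z = Re (\<i> * (1 + z) / (1 - z))" for z
  have l: "complex_of_real (l z) = \<i> * (1 + z) / (1 - z)" if "z \<in> ?Z" for z
    using tournament_eigenvalue_real[OF norm_root_minus_one] that assms
    by (simp add: l_def)
  have "?Z \<subseteq> - {1}" by auto
  then have inj: "inj_on l ?Z"
    using inj_on_subset[OF tournament_eigenvalue_inj] l unfolding inj_on_def by metis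
  \<comment> \<open>The \<open>(j, k)\<close> entry of the eigenprojection for \<open>z\<close>:
    column entry \<open>cnj z ^ j / of_nat n\<close> times row entry \<open>z ^ k\<close>, where
    \<open>1 / n\<close> normalises vectors of squared length \<open>n\<close>.\<close>
  define a where "a j k z = cnj z ^ j / of_nat n * z ^ k" for j k and z :: complex
  have U: "transition_matrix ?B t $$ (j, k) = (\<Sum>z\<in>?Z. exp (- \<i> * of_real (l z * t)) * a j k z)"
    if "j < n" "k < n" for j k t
    unfolding transition_matrix_def a_def
  proof (rule mat_exp_index_spectral[OF _ _ _ that])
    show "(\<Sum>z\<in>?Z. cnj z ^ r / of_nat n * z ^ c) = (if r = c then 1 else 0)" if "r < n" "c < n" for r c
      using sum_cnj_power_mult_power_roots_minus_one[OF that] that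
      by (simp flip: sum_divide_distrib)
  next
    fix z c assume zc: "z \<in> ?Z" "c < n"
    have "(\<Sum>r<n. z ^ r * ((- \<i> * of_real t) \<cdot>\<^sub>m ?B) $$ (r, c))
        = - \<i> * of_real t * (\<Sum>r<n. z ^ r * (if r < c then - \<i> else if r > c then \<i> else 0))"
      unfolding sum_distrib_left using zc by (intro sum.cong) auto
    also have "\<dots> = - \<i> * of_real (l z * t) * z ^ c"
      using zc by (simp only: tournament_eigenvalue l of_real_mult mem_Collect_eq) (simp only: mult_ac)
    finally show "(\<Sum>r<n. z ^ r * ((- \<i> * of_real t) \<cdot>\<^sub>m ?B) $$ (r, c)) = - \<i> * of_real (l z * t) * z ^ c" .
  qed simp
  have "((\<lambda>T. (1 / T) *\<^sub>R integral {0..T} (\<lambda>t. mixing_matrix ?B t $$ (j, k))) \<longlongrightarrow> 1 / of_nat n) at_top"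
    if "j < n" "k < n" for j k
  proof -
    have "norm (a j k z) = 1 / n" if "z \<in> ?Z" for z
      using norm_root_minus_one[of n z] that assms by (simp add: a_def norm_mult norm_divide norm_power)
    then have "(\<Sum>z\<in>?Z. complex_of_real ((norm (a j k z))\<^sup>2)) = (\<Sum>z\<in>?Z. of_real ((1 / n)\<^sup>2))"
      by (intro sum.cong) auto
    also have "\<dots> = 1 / of_nat n"
      using assms by (simp add: card_roots_minus_one power2_eq_square)
    finally have "(\<Sum>z\<in>?Z. complex_of_real ((norm (a j k z))\<^sup>2)) = 1 / of_nat n" .
    then show ?thesis
      using mean_norm_square_exp_sum[OF finite_roots_minus_one[OF assms] inj, of "a j k"] that
      by (simp add: mixing_matrix_def U)
  qed
  then show ?thesis
    by (simp add: average_uniform_mixing_def has_average_mixing_matrix_def all_ones_mat_def)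
qed

theorem corollary6:
  fixes n :: nat and B :: "complex mat"
  assumes "n \<ge> 2"
    and "B = mat n n (\<lambda>(j, k). if j < k then - \<i> else if j > k then \<i> else 0)"
  shows "B = (- \<i>) \<cdot>\<^sub>m skew_circulant n (\<lambda>j. if j = 0 then 0 else 1)
    \<and> average_uniform_mixing B"
proof
  have dim: "dim_row (skew_circulant n a) = n" "dim_col (skew_circulant n a) = n" for a
    by (simp_all add: skew_circulant_def)
  show "B = (- \<i>) \<cdot>\<^sub>m skew_circulant n (\<lambda>j. if j = 0 then 0 else 1)"
    \<comment> \<open>Below the diagonal the wrap sign turns \<open>- \<i>\<close> into
      \<open>\<i>\<close>; the index \<open>n + c - r\<close> is positive there, so the first row
      contributes 1.\<close>
    by (intro eq_matI) (auto simp: dim assms(2) skew_circulant_index)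
  show "average_uniform_mixing B"
    using assms tournament_average_uniform_mixing by simp
qed

end
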